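(* Let $G=(V,E)$ be a finite simple graph with $n$ vertices and $m$ edges, where $m>0$, and let $\omega(G)$ be the clique number of $G$. Then $$\frac{1}{\omega(G)}\le \alpha_0^{\mathcal{C}}(G)\le\frac12 .$$
   Context: Let $A$ be the adjacency matrix of $G$, $D$ the diagonal matrix of vertex degrees, and $L=D-A$ the Laplacian. $\langle M,N\rangle=\operatorname{tr}(M^TN)$. The set of copositive matrices is $$\mathcal{C}_n:=\{X\in\mathbb{R}^{n\times n}:\ X=X^T,\ h^TXh\ge 0\text{ for all } h\in\mathbb{R}^n \text{ with } h\ge 0 \text{ entrywise}\}.$$ The parameter $\alpha_0^{\mathcal{C}}=\alpha_0^{\mathcal{C}}(G)$ is the optimal value $$\alpha_0^{\mathcal{C}}:=\sup\{\langle X,-A\rangle:\ X\in\mathcal{C}_n,\ \langle X,L\rangle\le 1\}.$$ *)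

theory Defs
  imports "HOL-Analysis.Analysis" "HOL-Library.Ramsey"
begin

(* The vertex set is a finite type 'n; an edge is the two-element set of its end points,
   as for the library's clique predicate, which takes an edge set of this form. *)
definition simple_graph :: "'n set set \<Rightarrow> bool" where
  "simple_graph E \<longleftrightarrow> (\<forall>e\<in>E. card e = 2)"

definition clique_number :: "'n::finite set set \<Rightarrow> nat" where
  "clique_number E = Max (card ` {S. clique S E})"

definition degree :: "'n::finite set set \<Rightarrow> 'n \<Rightarrow> nat" where
  "degree E i = card {e \<in> E. i \<in> e}"

definition adjacency_matrix :: "'n::finite set set \<Rightarrow> real^'n^'n" where
  "adjacency_matrix E = (\<chi> i j. if {i, j} \<in> E then 1 else 0)"

definition degree_matrix :: "'n::finite set set \<Rightarrow> real^'n^'n" where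
  "degree_matrix E = (\<chi> i j. if i = j then real (degree E i) else 0)"

definition laplacian :: "'n::finite set set \<Rightarrow> real^'n^'n" where
  "laplacian E = degree_matrix E - adjacency_matrix E"

definition trace_inner :: "real^'n^'n \<Rightarrow> real^'n^'n \<Rightarrow> real" where
  "trace_inner M N = trace (transpose M ** N)"

definition copositive :: "(real^'n^'n) set" where
  "copositive = {X. X = transpose X \<and> (\<forall>h. (\<forall>i. 0 \<le> h $ i) \<longrightarrow> 0 \<le> h \<bullet> (X *v h))}"

(* The supremum is taken in the extended reals, because Sup on type real is unspecified
   for sets without an upper bound. *)
definition alpha0_cop :: "'n::finite set set \<Rightarrow> ereal" where
  "alpha0_cop E =
     (SUP X \<in> {X \<in> copositive. trace_inner X (laplacian E) \<le> 1}.
        ereal (trace_inner X (- adjacency_matrix E)))"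

end

theory Submission
  imports Defs
begin

text \<open>
  For the upper bound, test copositivity of \<open>X\<close> on the vectors \<open>e\<^sub>i + e\<^sub>j\<close> and sum over the edges:
  this gives \<open>\<langle>X, -A\<rangle> \<le> \<langle>X, D\<rangle>\<close>, so \<open>2 \<langle>X, -A\<rangle> \<le> \<langle>X, L\<rangle> \<le> 1\<close>.

  For the lower bound, the Motzkin--Straus inequality says that \<open>(1 - 1/\<omega>) J - A\<close> is copositive,
  where \<open>J\<close> is the all-ones matrix. As \<open>\<langle>J, L\<rangle> = 0\<close> and \<open>\<langle>A, D\<rangle> = 0\<close>, dividing this matrix
  by \<open>\<langle>A, A\<rangle>\<close> gives a feasible point with value \<open>1/\<omega>\<close>.
\<close>

section \<open>The trace inner product and vertex degrees as entrywise sums\<close>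

lemma trace_inner_eq_sum:
  "trace_inner M N = (\<Sum>i\<in>UNIV. \<Sum>j\<in>UNIV. M $ i $ j * N $ i $ j)"
proof -
  have "trace_inner M N = (\<Sum>j\<in>UNIV. \<Sum>i\<in>UNIV. M $ i $ j * N $ i $ j)"
    by (simp add: trace_inner_def trace_def transpose_def matrix_matrix_mult_def)
  also have "\<dots> = (\<Sum>i\<in>UNIV. \<Sum>j\<in>UNIV. M $ i $ j * N $ i $ j)"
    by (rule sum.swap)
  finally show ?thesis .
qed

lemma trace_inner_diff_right: "trace_inner M (N - P) = trace_inner M N - trace_inner M P"
  by (simp add: trace_inner_eq_sum right_diff_distrib sum_subtractf)

lemma trace_inner_uminus_right: "trace_inner M (- N) = - trace_inner M N"
  by (simp add: trace_inner_eq_sum sum_negf)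

lemma inner_matrix_vector_eq_sum:
  fixes A :: "real^'n^'n"
  shows "x \<bullet> (A *v y) = (\<Sum>i\<in>UNIV. \<Sum>j\<in>UNIV. A $ i $ j * (x $ i * y $ j))"
  by (simp add: inner_vec_def matrix_vector_mult_def sum_distrib_left mult_ac)

lemma inner_axis_matrix_axis:
  fixes A :: "real^'n^'n"
  shows "axis i 1 \<bullet> (A *v axis j 1) = A $ i $ j"
  by (simp add: matrix_vector_mult_basis column_def inner_axis')

lemma adjacency_matrix_component [simp]:
  "adjacency_matrix E $ i $ j = (if {i, j} \<in> E then 1 else 0)"
  by (simp add: adjacency_matrix_def)

lemma adjacency_matrix_commute: "adjacency_matrix E $ i $ j = adjacency_matrix E $ j $ i"
  by (simp add: insert_commute)

lemma transpose_adjacency_matrix: "transpose (adjacency_matrix E) = adjacency_matrix E"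
  by (simp add: vec_eq_iff transpose_def insert_commute)

lemma simple_graph_no_loop: "simple_graph E \<Longrightarrow> {i} \<notin> E"
  by (auto simp: simple_graph_def)

text \<open>Edges at \<open>i\<close> correspond to neighbours of \<open>i\<close> through
  \<open>j \<mapsto> {i, j}\<close>; this map is onto because every edge has exactly two end
  points.\<close>

lemma degree_eq_sum_adjacency:
  assumes "simple_graph E"
  shows "real (degree E i) = (\<Sum>j\<in>UNIV. adjacency_matrix E $ i $ j)"
proof -
  have "bij_betw (\<lambda>j. {i, j}) {j. {i, j} \<in> E} {e \<in> E. i \<in> e}"
  proof (rule bij_betwI')
    show "({i, x} = {i, y}) = (x = y)" for x y
      by (auto simp: doubleton_eq_iff)
    show "\<exists>x\<in>{j. {i, j} \<in> E}. e = {i, x}" if "e \<in> {e \<in> E. i \<in> e}" for e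
    proof -
      have "card e = 2" using that assms by (auto simp: simple_graph_def)
      then obtain y z where yz: "e = {y, z}"
        by (auto simp: card_2_iff)
      with that have "e = {i, if i = y then z else y}" by auto
      then obtain x where "e = {i, x}" by blast
      then show ?thesis using that by auto
    qed
  qed auto
  then have "degree E i = card {j. {i, j} \<in> E}"
    by (simp add: degree_def bij_betw_same_card)
  also have "real \<dots> = (\<Sum>j\<in>UNIV. if {i, j} \<in> E then 1 else 0)"
    by (simp add: sum.If_cases)
  finally show ?thesis by simp
qed

text \<open>Spreading each degree over the neighbours turns the diagonal pairing into a sum over
  ordered adjacent pairs, the same index set as for the pairing with the adjacency matrix.\<close>

lemma trace_inner_degree_matrix:
  assumes "simple_graph E"
  shows "trace_inner X (degree_matrix E) =
    (\<Sum>i\<in>UNIV. \<Sum>j\<in>UNIV. adjacency_matrix E $ i $ j * X $ i $ i)"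
proof -
  have "trace_inner X (degree_matrix E) = (\<Sum>i\<in>UNIV. real (degree E i) * X $ i $ i)"
    by (simp add: trace_inner_eq_sum degree_matrix_def if_distrib mult.commute cong: if_cong)
  then show ?thesis
    by (simp add: degree_eq_sum_adjacency[OF assms] sum_distrib_right
        del: adjacency_matrix_component)
qed

lemma trace_inner_laplacian:
  "trace_inner X (laplacian E) =
    trace_inner X (degree_matrix E) - trace_inner X (adjacency_matrix E)"
  by (simp add: laplacian_def trace_inner_diff_right)

section \<open>The upper bound\<close>

lemma copositive_diagonal_pair:
  assumes "X \<in> copositive"
  shows "0 \<le> X $ i $ i + X $ j $ j + 2 * X $ i $ j"
proof -
  let ?h = "axis i 1 + axis j 1 :: real^'a"
  have "\<forall>k. 0 \<le> ?h $ k" by (simp add: axis_def)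
  then have "0 \<le> ?h \<bullet> (X *v ?h)"
    using assms by (simp add: copositive_def)
  also have "\<dots> = X $ i $ i + X $ i $ j + X $ j $ i + X $ j $ j"
    by (simp add: matrix_vector_right_distrib inner_simps inner_axis_matrix_axis)
  also have "X $ j $ i = X $ i $ j"
    using assms by (simp add: copositive_def vec_eq_iff transpose_def)
  finally show ?thesis by simp
qed

lemma trace_inner_adjacency_le_half:
  fixes E :: "'n::finite set set"
  assumes E: "simple_graph E" and X: "X \<in> copositive" and le: "trace_inner X (laplacian E) \<le> 1"
  shows "trace_inner X (- adjacency_matrix E) \<le> 1 / 2"
proof -
  let ?a = "\<lambda>i j. adjacency_matrix E $ i $ j"
  \<comment> \<open>By symmetry of the adjacency matrix, both end points of an edge contribute the
    same total.\<close>
  have swap: "(\<Sum>i\<in>UNIV. \<Sum>j\<in>UNIV. ?a i j * X $ j $ j) = (\<Sum>i\<in>UNIV. \<Sum>j\<in>UNIV. ?a i j * X $ i $ i)"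
    by (subst sum.swap, subst adjacency_matrix_commute, rule refl)
  have "0 \<le> (\<Sum>i\<in>UNIV. \<Sum>j\<in>UNIV. ?a i j * (X $ i $ i + X $ j $ j + 2 * X $ i $ j))"
    using copositive_diagonal_pair[OF X] by (intro sum_nonneg mult_nonneg_nonneg) auto
  also have "\<dots> = (\<Sum>i\<in>UNIV. \<Sum>j\<in>UNIV. ?a i j * X $ i $ i) +
      (\<Sum>i\<in>UNIV. \<Sum>j\<in>UNIV. ?a i j * X $ j $ j) + 2 * (\<Sum>i\<in>UNIV. \<Sum>j\<in>UNIV. X $ i $ j * ?a i j)"
    by (simp add: sum.distrib sum_distrib_left algebra_simps del: adjacency_matrix_component)
  also have "\<dots> = 2 * trace_inner X (degree_matrix E) + 2 * trace_inner X (adjacency_matrix E)"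
    unfolding swap trace_inner_degree_matrix[OF E] trace_inner_eq_sum[of X "adjacency_matrix E"]
    by (simp del: adjacency_matrix_component)
  finally show ?thesis
    using le by (simp add: trace_inner_laplacian trace_inner_uminus_right)
qed

section \<open>The clique number and the Motzkin--Straus inequality\<close>

lemma card_le_clique_number: "clique S E \<Longrightarrow> card S \<le> clique_number E"
  by (simp add: clique_number_def)

text \<open>A singleton is vacuously a clique; \<open>undefined\<close> stands for an arbitrary
  vertex.\<close>

lemma clique_number_pos: "0 < clique_number E"
  using card_le_clique_number[of "{undefined}" E] by (simp add: clique_def)

text \<open>The coefficient of \<open>t\<^sup>2\<close> is
  \<open>A $ i $ i + A $ j $ j - 2 * A $ i $ j\<close>, which vanishes, and symmetry merges the two
  cross terms.\<close>

lemma quadratic_form_transfer_mass: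
  fixes A :: "real^'n^'n"
  assumes sym: "transpose A = A" and "A $ i $ i = 0" "A $ j $ j = 0" "A $ i $ j = 0"
  defines "d \<equiv> axis i 1 - axis j 1"
  shows "(h + t *\<^sub>R d) \<bullet> (A *v (h + t *\<^sub>R d)) = h \<bullet> (A *v h) + 2 * t * ((A *v h) $ i - (A *v h) $ j)"
proof -
  have "A $ j $ i = 0"
    using assms(4) sym by (metis transpose_def vec_lambda_beta)
  then have dd: "d \<bullet> (A *v d) = 0"
    using assms by (simp add: matrix_vector_mult_diff_distrib inner_simps inner_axis_matrix_axis)
  have dh: "d \<bullet> (A *v h) = (A *v h) $ i - (A *v h) $ j"
    by (simp add: d_def inner_simps inner_axis')
  have "h \<bullet> (A *v d) = d \<bullet> (A *v h)"
    using dot_lmul_matrix[of h A d] sym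
    by (metis inner_commute vector_transpose_matrix)
  then have "(h + t *\<^sub>R d) \<bullet> (A *v (h + t *\<^sub>R d)) = h \<bullet> (A *v h) + 2 * t * (d \<bullet> (A *v h))"
    using dd by (simp add: matrix_vector_right_distrib matrix_vector_mult_scaleR inner_simps)
  then show ?thesis by (simp only: dh)
qed

text \<open>On a clique every off-diagonal product is counted, so the form is the squared sum minus
  the sum of squares. Cauchy--Schwarz on the support bounds the latter from below.\<close>

lemma motzkin_straus_clique:
  fixes h :: "real^'n::finite"
  assumes E: "simple_graph E" and clique: "clique {i. h $ i \<noteq> 0} E"
  shows "h \<bullet> (adjacency_matrix E *v h)
    \<le> (1 - 1 / real (clique_number E)) * (\<Sum>i\<in>UNIV. h $ i)\<^sup>2"
proof -
  define S where "S = {i. h $ i \<noteq> 0}"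
  define w where "w = real (clique_number E)"
  have w: "0 < w" "real (card S) \<le> w"
    using clique_number_pos card_le_clique_number[OF clique] by (auto simp: w_def S_def)
  have "adjacency_matrix E $ i $ j * (h $ i * h $ j)
      = h $ i * h $ j - (if i = j then (h $ i)\<^sup>2 else 0)" for i j
    using clique simple_graph_no_loop[OF E]
    by (auto simp: clique_def power2_eq_square)
  then have "h \<bullet> (adjacency_matrix E *v h)
      = (\<Sum>i\<in>UNIV. \<Sum>j\<in>UNIV. h $ i * h $ j - (if i = j then (h $ i)\<^sup>2 else 0))"
    by (simp add: inner_matrix_vector_eq_sum)
  also have "\<dots> = (\<Sum>i\<in>UNIV. h $ i)\<^sup>2 - (\<Sum>i\<in>UNIV. (h $ i)\<^sup>2)"
    by (simp add: sum_subtractf power2_eq_square sum_product)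
  finally have eq: "h \<bullet> (adjacency_matrix E *v h) = (\<Sum>i\<in>UNIV. h $ i)\<^sup>2 - (\<Sum>i\<in>UNIV. (h $ i)\<^sup>2)" .
  have "(\<Sum>i\<in>UNIV. h $ i)\<^sup>2 = (\<Sum>i\<in>S. h $ i)\<^sup>2"
    by (subst sum.mono_neutral_right[of UNIV S]) (auto simp: S_def)
  also have "\<dots> \<le> (\<Sum>i\<in>S. (h $ i)\<^sup>2) * real (card S)"
    by (rule sum_squared_le_sum_of_squares)
  also have "(\<Sum>i\<in>S. (h $ i)\<^sup>2) = (\<Sum>i\<in>UNIV. (h $ i)\<^sup>2)"
    by (rule sum.mono_neutral_left) (auto simp: S_def)
  also have "\<dots> * real (card S) \<le> (\<Sum>i\<in>UNIV. (h $ i)\<^sup>2) * w"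
    using w by (intro mult_left_mono sum_nonneg) auto
  finally show ?thesis
    using w by (simp add: eq w_def[symmetric] field_simps)
qed

text \<open>
  If two vertices of the support are not adjacent, then the form is affine in the amount of mass
  moved from one to the other, so one of them can be removed from the support without decreasing
  the form. The induction ends when the support is a clique.
\<close>

lemma motzkin_straus:
  fixes h :: "real^'n::finite"
  assumes E: "simple_graph E" and nonneg: "\<And>i. 0 \<le> h $ i"
  shows "h \<bullet> (adjacency_matrix E *v h)
    \<le> (1 - 1 / real (clique_number E)) * (\<Sum>i\<in>UNIV. h $ i)\<^sup>2"
  using nonneg
proof (induction "card {i. h $ i \<noteq> 0}" arbitrary: h rule: less_induct)
  case less
  let ?A = "adjacency_matrix E"
  show ?case
  proof (cases "clique {i. h $ i \<noteq> 0} E")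
    case True
    then show ?thesis by (rule motzkin_straus_clique[OF E])
  next
    case False
    then obtain k l where kl: "h $ k \<noteq> 0" "h $ l \<noteq> 0" "k \<noteq> l" "{k, l} \<notin> E"
      by (auto simp: clique_def)
    \<comment> \<open>The two vertices are ordered so that moving mass from \<open>j\<close> to
      \<open>i\<close> does not decrease the form.\<close>
    obtain i j where ij: "h $ i \<noteq> 0" "h $ j \<noteq> 0" "i \<noteq> j" "{i, j} \<notin> E"
      and ge: "(?A *v h) $ j \<le> (?A *v h) $ i"
    proof (cases "(?A *v h) $ l \<le> (?A *v h) $ k")
      case True
      then show ?thesis using kl that by blast
    next
      case False
      then show ?thesis using kl that[of l k] by (simp add: insert_commute)
    qed
    \<comment> \<open>Moving exactly \<open>h $ j\<close> empties \<open>j\<close>, so the support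
      shrinks while the total mass stays the same.\<close>
    define g where "g = h + (h $ j) *\<^sub>R (axis i 1 - axis j 1)"
    have g: "g $ k = (if k = i then h $ i + h $ j else if k = j then 0 else h $ k)" for k
      using ij by (simp add: g_def axis_def)
    have g_nonneg: "0 \<le> g $ k" for k
      using less.prems by (simp add: g)
    have "{k. g $ k \<noteq> 0} \<subset> {k. h $ k \<noteq> 0}"
      using ij by (auto simp: g split: if_splits)
    then have "card {k. g $ k \<noteq> 0} < card {k. h $ k \<noteq> 0}"
      by (simp add: psubset_card_mono)
    then have IH: "g \<bullet> (?A *v g) \<le> (1 - 1 / real (clique_number E)) * (\<Sum>i\<in>UNIV. g $ i)\<^sup>2"
      using less.hyps g_nonneg by blast
    have "(\<Sum>i\<in>UNIV. g $ i) = (\<Sum>i\<in>UNIV. h $ i)"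
      by (simp add: g_def sum.distrib sum_distrib_left[symmetric] sum_subtractf axis_def)
    moreover have "g \<bullet> (?A *v g) = h \<bullet> (?A *v h) + 2 * h $ j * ((?A *v h) $ i - (?A *v h) $ j)"
      unfolding g_def using ij simple_graph_no_loop[OF E]
      by (intro quadratic_form_transfer_mass transpose_adjacency_matrix) auto
    moreover have "0 \<le> 2 * h $ j * ((?A *v h) $ i - (?A *v h) $ j)"
      using less.prems ge by simp
    ultimately show ?thesis using IH by simp
  qed
qed

section \<open>A feasible point for the lower bound, and the conclusion\<close>

lemma motzkin_straus_matrix_feasible:
  fixes E :: "'n::finite set set"
  assumes E: "simple_graph E" and ne: "E \<noteq> {}"
  obtains X where "X \<in> copositive" "trace_inner X (laplacian E) = 1"
    "trace_inner X (- adjacency_matrix E) = 1 / real (clique_number E)"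
proof -
  let ?A = "adjacency_matrix E"
  define c where "c = 1 - 1 / real (clique_number E)"
  \<comment> \<open>As the entries are 0 or 1, this is the squared norm of \<open>?A\<close>; an
    edge makes it positive.\<close>
  define s where "s = (\<Sum>i\<in>UNIV. \<Sum>j\<in>UNIV. ?A $ i $ j)"
  define X :: "real^'n^'n" where "X = (\<chi> i j. (c - ?A $ i $ j) / s)"
  obtain e where "e \<in> E" "card e = 2"
    using E ne by (auto simp: simple_graph_def)
  then obtain k l where "{k, l} \<in> E"
    by (auto simp: card_2_iff)
  then have "0 < (\<Sum>j\<in>UNIV. ?A $ k $ j)"
    by (intro sum_pos2[where i = l]) auto
  then have s: "0 < s"
    unfolding s_def by (rule sum_pos2[where i = k, rotated 2]) (auto intro: sum_nonneg)
  have X_copositive: "X \<in> copositive"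
  proof -
    have "0 \<le> h \<bullet> (X *v h)" if "\<forall>i. 0 \<le> h $ i" for h
    proof -
      have "h \<bullet> (X *v h) = (\<Sum>i\<in>UNIV. \<Sum>j\<in>UNIV. (c * (h $ i * h $ j) - ?A $ i $ j * (h $ i * h $ j)) / s)"
        by (simp add: inner_matrix_vector_eq_sum X_def left_diff_distrib
            del: adjacency_matrix_component)
      also have "\<dots> = (c * (\<Sum>i\<in>UNIV. h $ i)\<^sup>2 - h \<bullet> (?A *v h)) / s"
        by (simp add: inner_matrix_vector_eq_sum sum_subtractf sum_divide_distrib[symmetric]
            sum_distrib_left[symmetric] power2_eq_square sum_product
            del: adjacency_matrix_component)
      finally show ?thesis
        using motzkin_straus[OF E, of h] that s by (simp add: c_def)
    qed
    moreover have "X = transpose X"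
      by (simp add: X_def vec_eq_iff transpose_def insert_commute)
    ultimately show ?thesis by (simp add: copositive_def)
  qed
  \<comment> \<open>Only adjacent pairs matter here, and there the entry of \<open>X\<close> is
    \<open>(c - 1) / s\<close>.\<close>
  have "X $ i $ j * ?A $ i $ j = (c - 1) / s * ?A $ i $ j" for i j
    by (simp add: X_def)
  then have "trace_inner X ?A = (c - 1) / s * s"
    by (simp add: trace_inner_eq_sum s_def sum_distrib_left del: adjacency_matrix_component)
  then have XA: "trace_inner X ?A = c - 1"
    using s by simp
  \<comment> \<open>Without loops the diagonal of \<open>?A\<close> is zero, so that of
    \<open>X\<close> is constantly \<open>c / s\<close>.\<close>
  have "?A $ i $ j * X $ i $ i = c / s * ?A $ i $ j" for i j
    using simple_graph_no_loop[OF E] by (simp add: X_def)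
  then have "trace_inner X (degree_matrix E) = c / s * s"
    by (simp add: trace_inner_degree_matrix[OF E] s_def sum_distrib_left
        del: adjacency_matrix_component)
  then have XD: "trace_inner X (degree_matrix E) = c"
    using s by simp
  \<comment> \<open>The Laplacian pairing is \<open>c - (c - 1) = 1\<close>, and the objective is
    \<open>1 - c\<close>, the reciprocal of the clique number.\<close>
  show ?thesis
    using that[OF X_copositive] XA XD
    by (simp add: trace_inner_laplacian trace_inner_uminus_right c_def)
qed

theorem theorem9:
  fixes E :: "'n::finite set set"
  assumes "simple_graph E"
    and "card E > 0"
  shows "ereal (1 / real (clique_number E)) \<le> alpha0_cop E \<and> alpha0_cop E \<le> ereal (1 / 2)"
proof
  have "E \<noteq> {}" using assms(2) by auto
  then obtain X where X: "X \<in> copositive" "trace_inner X (laplacian E) = 1"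
      "trace_inner X (- adjacency_matrix E) = 1 / real (clique_number E)"
    using motzkin_straus_matrix_feasible[OF assms(1)] by blast
  show "ereal (1 / real (clique_number E)) \<le> alpha0_cop E"
    unfolding alpha0_cop_def by (rule SUP_upper2[of X]) (use X in auto)
  show "alpha0_cop E \<le> ereal (1 / 2)"
    unfolding alpha0_cop_def
    using trace_inner_adjacency_le_half[OF assms(1)] by (intro SUP_least) auto
qed

end
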